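(* Let $(W,S)$ be a Coxeter system, let $(X,\mathrm{ht})$ be a quasiparabolic $W$-set, and let $W_I\subset W$ ($I\subset S$) be a standard parabolic subgroup. If $x,y\in X$ are in the same bounded $W_I$-orbit, then $x\le y$ in the Bruhat order of the quasiparabolic $W$-set $X$ if and only if $x\le y$ in the Bruhat order of $X|_{W_I}$, i.e. of $(X,\mathrm{ht})$ regarded as a quasiparabolic $W_I$-set.
   Context: Coxeter systems $(W,S)$ have finite rank; $R(W)$ is the set of reflections, i.e. conjugates in $W$ of elements of $S$. The standard parabolic subgroup $W_I$ is generated by $I\subset S$, with Coxeter system $(W_I,I)$. A scaled $W$-set is a pair $(X,\mathrm{ht})$ with $X$ a (left) $W$-set and $\mathrm{ht}:X\to\mathbb Z$ a function with $|\mathrm{ht}(sx)-\mathrm{ht}(x)|\le 1$ for all $s\in S$, $x\in X$. A quasiparabolic $W$-set is a scaled $W$-set such that (QP1) for all $r\in R(W)$, $x\in X$, if $\mathrm{ht}(rx)=\mathrm{ht}(x)$ then $rx=x$; and (QP2) for all $r\in R(W)$, $x\in X$, $s\in S$, if $\mathrm{ht}(rx)>\mathrm{ht}(x)$ and $\mathrm{ht}(srx)<\mathrm{ht}(sx)$, then $rx=sx$. Any quasiparabolic $W$-set is also a quasiparabolic $W_I$-set. The Bruhat order on a quasiparabolic $W$-set is the weakest partial order such that for $x\in X$, $r\in R(W)$, $x\le rx$ iff $\mathrm{ht}(x)\le\mathrm{ht}(rx)$ (i.e. the reflexive-transitive closure of the relations $x<rx$ with $r \in R(W)$, $\mathrm{ht}(x)<\mathrm{ht}(rx)$).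 "Bounded" means that the height is bounded from below or bounded from above (on the orbit in question). *)

theory Defs
  imports "HOL-Algebra.Generated_Groups" "HOL-Algebra.Group_Action"
begin

section \<open>Coxeter systems\<close>

text \<open>A Coxeter matrix; the value \<open>0\<close> encodes the entry \<open>\<infinity>\<close> (no relation between \<open>s\<close> and \<open>t\<close>).\<close>

definition coxeter_matrix :: "'w set \<Rightarrow> ('w \<Rightarrow> 'w \<Rightarrow> nat) \<Rightarrow> bool" where
  "coxeter_matrix S m \<longleftrightarrow>
     (\<forall>s\<in>S. \<forall>t\<in>S. m s t = m t s \<and> (m s t = 1 \<longleftrightarrow> s = t))"

definition word_prod :: "('w, 'b) monoid_scheme \<Rightarrow> 'w list \<Rightarrow> 'w" where
  "word_prod G w = foldr (mult G) w (one G)"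

text \<open>Insertion of a relator \<open>(st)\<^sup>m\<close>, \<open>m = m(s,t) < \<infinity>\<close>, into a word over \<open>S\<close>.\<close>

inductive insert_relator :: "'w set \<Rightarrow> ('w \<Rightarrow> 'w \<Rightarrow> nat) \<Rightarrow> 'w list \<Rightarrow> 'w list \<Rightarrow> bool"
  for S m where
  "\<lbrakk>u \<in> lists S; v \<in> lists S; s \<in> S; t \<in> S; m s t \<noteq> 0\<rbrakk>
    \<Longrightarrow> insert_relator S m (u @ v) (u @ concat (replicate (m s t) [s, t]) @ v)"

text \<open>
  The axiom \<open>presentation\<close> says that \<open>W = \<langle>S | (st)\<^bsup>m(s,t)\<^esup> = 1\<rangle>\<close>: two words represent the same
  element of \<open>W\<close> iff they are congruent modulo the relators. Words in the generators suffice
  (formal inverses are not needed) because \<open>m(s,s) = 1\<close> provides the relator \<open>s s\<close>. Finite rank is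
  part of the definition.
\<close>

locale coxeter_system = group W for W (structure) +
  fixes S :: "'a set"
  assumes finite_rank: "finite S"
    and gens_carrier: "S \<subseteq> carrier W"
    and gens_generate: "generate W S = carrier W"
    and presentation: "\<exists>m. coxeter_matrix S m \<and>
      (\<forall>u\<in>lists S. \<forall>v\<in>lists S.
         word_prod W u = word_prod W v \<longleftrightarrow> equivclp (insert_relator S m) u v)"

text \<open>The standard parabolic subgroup of \<open>I \<subseteq> S\<close> is \<^term>\<open>subgroup_generated W I\<close>; its set of
  reflections is \<open>reflections (subgroup_generated W I) I\<close>.\<close>

definition reflections :: "('w, 'b) monoid_scheme \<Rightarrow> 'w set \<Rightarrow> 'w set" where
  "reflections G S = {g \<otimes>\<^bsub>G\<^esub> s \<otimes>\<^bsub>G\<^esub> inv\<^bsub>G\<^esub> g | g s. g \<in> carrier G \<and> s \<in> S}"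


section \<open>Quasiparabolic sets\<close>

text \<open>The locales below do not assume that \<open>(W, S)\<close> is a Coxeter system.\<close>

locale scaled_set = group_action W X \<phi>
  for W (structure) and S :: "'a set" and X :: "'x set" and \<phi> :: "'a \<Rightarrow> 'x \<Rightarrow> 'x"
    and ht :: "'x \<Rightarrow> int" +
  assumes ht_step: "\<lbrakk>s \<in> S; x \<in> X\<rbrakk> \<Longrightarrow> \<bar>ht (\<phi> s x) - ht x\<bar> \<le> 1"

locale quasiparabolic_set = scaled_set W S X \<phi> ht
  for W (structure) and S :: "'a set" and X :: "'x set" and \<phi> :: "'a \<Rightarrow> 'x \<Rightarrow> 'x"
    and ht :: "'x \<Rightarrow> int" +
  assumes QP1: "\<lbrakk>r \<in> reflections W S; x \<in> X; ht (\<phi> r x) = ht x\<rbrakk> \<Longrightarrow> \<phi> r x = x"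
    and QP2: "\<lbrakk>r \<in> reflections W S; x \<in> X; s \<in> S; ht (\<phi> r x) > ht x;
               ht (\<phi> s (\<phi> r x)) < ht (\<phi> s x)\<rbrakk> \<Longrightarrow> \<phi> r x = \<phi> s x"

text \<open>The intersection only restricts the reflexive closure to points of \<open>X\<close>.\<close>

definition bruhat_order ::
  "('w, 'b) monoid_scheme \<Rightarrow> 'w set \<Rightarrow> 'x set \<Rightarrow> ('w \<Rightarrow> 'x \<Rightarrow> 'x) \<Rightarrow> ('x \<Rightarrow> int) \<Rightarrow> 'x rel" where
  "bruhat_order W S X \<phi> ht =
     {(x, \<phi> r x) | x r. x \<in> X \<and> r \<in> reflections W S \<and> ht x < ht (\<phi> r x)}\<^sup>* \<inter> X \<times> X"

lemma reflections_subset_carrier: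
  assumes "group G" "S \<subseteq> carrier G"
  shows "reflections G S \<subseteq> carrier G"
proof -
  interpret group G by fact
  show ?thesis using assms(2) by (auto simp: reflections_def)
qed

text \<open>\<^const>\<open>bruhat_order\<close> is the weakest partial order on \<open>X\<close> such that, for all \<open>x\<close> and all
  reflections \<open>r\<close>, \<open>x \<le> r x\<close> iff \<open>ht x \<le> ht (r x)\<close>.\<close>

lemma (in quasiparabolic_set) bruhat_order_weakest:
  assumes S: "S \<subseteq> carrier W"
  shows "partial_order_on X (bruhat_order W S X \<phi> ht)"
    and "\<lbrakk>x \<in> X; r \<in> reflections W S\<rbrakk>
      \<Longrightarrow> (x, \<phi> r x) \<in> bruhat_order W S X \<phi> ht \<longleftrightarrow> ht x \<le> ht (\<phi> r x)"
    and "\<lbrakk>partial_order_on X P;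
          \<forall>x\<in>X. \<forall>r\<in>reflections W S. (x, \<phi> r x) \<in> P \<longleftrightarrow> ht x \<le> ht (\<phi> r x)\<rbrakk>
      \<Longrightarrow> bruhat_order W S X \<phi> ht \<subseteq> P"
proof -
  let ?B = "bruhat_order W S X \<phi> ht"
  let ?R = "{(x, \<phi> r x) | x r. x \<in> X \<and> r \<in> reflections W S \<and> ht x < ht (\<phi> r x)}"
  have "group W" using group_hom group_hom.axioms(1) by blast
  then have refl_carrier: "reflections W S \<subseteq> carrier W"
    by (rule reflections_subset_carrier) (rule S)
  have closed: "\<phi> r x \<in> X" if "x \<in> X" "r \<in> reflections W S" for x r
    using that refl_carrier element_image by blast
  have ht_mono: "x = y \<or> ht x < ht y" if "(x, y) \<in> ?R\<^sup>*" for x y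
    using that by (induction rule: rtrancl_induct) auto
  have antisymm: "antisym ?B"
  proof (rule antisymI)
    fix x y assume "(x, y) \<in> ?B" "(y, x) \<in> ?B"
    then show "x = y" using ht_mono[of x y] ht_mono[of y x] by (auto simp: bruhat_order_def)
  qed
  have trans: "trans ?B"
    unfolding bruhat_order_def by (rule transI) (auto intro: rtrancl_trans)
  have "refl_on X ?B"
    unfolding refl_on_def bruhat_order_def by simp
  with antisymm trans show "partial_order_on X ?B"
    by (auto simp: partial_order_on_def preorder_on_def bruhat_order_def)
  show "(x, \<phi> r x) \<in> ?B \<longleftrightarrow> ht x \<le> ht (\<phi> r x)" if xr: "x \<in> X" "r \<in> reflections W S" for x r
  proof
    assume "(x, \<phi> r x) \<in> ?B"
    then show "ht x \<le> ht (\<phi> r x)"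
      using ht_mono[of x "\<phi> r x"] by (auto simp: bruhat_order_def)
  next
    assume "ht x \<le> ht (\<phi> r x)"
    then consider "ht x < ht (\<phi> r x)" | "\<phi> r x = x" using QP1[OF xr(2,1)] by fastforce
    then show "(x, \<phi> r x) \<in> ?B"
      by cases (use xr closed[OF xr] in \<open>auto simp: bruhat_order_def intro!: r_into_rtrancl\<close>)
  qed
  show "?B \<subseteq> P" if P: "partial_order_on X P"
    and PR: "\<forall>x\<in>X. \<forall>r\<in>reflections W S. (x, \<phi> r x) \<in> P \<longleftrightarrow> ht x \<le> ht (\<phi> r x)"
  proof -
    have "(x, y) \<in> P" if "(x, y) \<in> ?R\<^sup>*" "x \<in> X" for x y
      using that
    proof (induction rule: rtrancl_induct)
      case base
      then show ?case using P by (auto simp: partial_order_on_def preorder_on_def refl_on_def)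
    next
      case (step y z)
      then have "(x, y) \<in> P" "(y, z) \<in> P" using PR by auto
      then show ?case using P by (auto simp: partial_order_on_def preorder_on_def dest: transD)
    qed
    then show ?thesis by (auto simp: bruhat_order_def)
  qed
qed

lemma (in quasiparabolic_set) quasiparabolic_set_parabolic:
  assumes S: "S \<subseteq> carrier W" and I: "I \<subseteq> S"
  shows "quasiparabolic_set (subgroup_generated W I) I X \<phi> ht"
proof -
  interpret hom: group_hom W "BijGroup X" \<phi> by (rule group_hom)
  let ?WI = "subgroup_generated W I"
  have sub: "carrier ?WI \<subseteq> carrier W" 
    by (rule group.carrier_subgroup_generated_subset) (rule hom.G.is_group)
  have "group_hom ?WI (BijGroup X) \<phi>"
    unfolding group_hom_def group_hom_axioms_def
    using group.hom_from_subgroup_generated[OF hom.G.is_group hom.homh] hom.G.is_group hom.H.is_group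
    by (auto intro: group.group_subgroup_generated)
  moreover have "reflections ?WI I \<subseteq> reflections W S"
    using sub I unfolding reflections_def by fastforce
  ultimately show ?thesis
    using I QP1 QP2 ht_step
    unfolding quasiparabolic_set_def quasiparabolic_set_axioms_def scaled_set_def
      scaled_set_axioms_def group_action_def
    by (meson subsetD)
qed

end

theory Submission
  imports Defs
begin

text \<open>
  For \<open>s \<in> S\<close>, both \<open>x \<mapsto> min (x, s x)\<close> and \<open>x \<mapsto> max (x, s x)\<close> preserve the Bruhat order: by
  (QP2), a step \<open>x < r x\<close> either has \<open>r x = s x\<close> or is carried by \<open>s\<close> to a step \<open>s x \<le> s r x\<close>.
  Consequently, an element that no \<open>s \<in> I\<close> lowers lies below its whole \<open>W\<^sub>I\<close>-orbit. In a
  \<open>W\<^sub>I\<close>-orbit bounded below, \<open>x \<le> y\<close> is then transferred to \<open>W\<^sub>I\<close> by induction on the height of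
  \<open>y\<close>: if \<open>s \<in> I\<close> lowers \<open>y\<close>, apply the induction hypothesis to \<open>min (x, s x) \<le> s y\<close> and take the
  maximum with respect to \<open>s\<close> in \<open>W\<^sub>I\<close>. Negating the height reverses the order and exchanges
  the two kinds of boundedness.
\<close>

text \<open>Both definitions test the same strict inequality, so \<open>lower\<close> and
  \<open>upper\<close> pick complementary elements of the pair \<open>x\<close>,
  \<open>\<phi> s x\<close>. For \<open>s \<in> S\<close> and \<open>x \<in> X\<close> a tie means,
  by (QP1), that the pair is a single point.\<close>

definition lower :: "('w \<Rightarrow> 'x \<Rightarrow> 'x) \<Rightarrow> ('x \<Rightarrow> int) \<Rightarrow> 'w \<Rightarrow> 'x \<Rightarrow> 'x" where
  "lower \<phi> ht s x = (if ht (\<phi> s x) < ht x then \<phi> s x else x)"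

definition upper :: "('w \<Rightarrow> 'x \<Rightarrow> 'x) \<Rightarrow> ('x \<Rightarrow> int) \<Rightarrow> 'w \<Rightarrow> 'x \<Rightarrow> 'x" where
  "upper \<phi> ht s x = (if ht (\<phi> s x) < ht x then x else \<phi> s x)"

section \<open>Generators and reflections as involutions\<close>

lemma (in coxeter_system) gens_square:
  assumes "s \<in> S"
  shows "s \<otimes> s = \<one>"
proof -
  obtain m where m: "coxeter_matrix S m"
    and eq: "\<forall>u\<in>lists S. \<forall>v\<in>lists S.
      word_prod W u = word_prod W v \<longleftrightarrow> equivclp (insert_relator S m) u v"
    using presentation by blast
  have m1: "m s s = 1" using m assms by (auto simp: coxeter_matrix_def)
  \<comment> \<open>The diagonal entry 1 makes \<open>[s, s]\<close> itself a relator, here inserted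
    into the empty word.\<close>
  have "insert_relator S m ([] @ []) ([] @ concat (replicate (m s s) [s, s]) @ [])"
    by (rule insert_relator.intros) (use assms m1 in auto)
  then have "equivclp (insert_relator S m) [] [s, s]"
    using m1 by (simp add: r_into_equivclp)
  then have "word_prod W [] = word_prod W [s, s]" using eq assms by auto
  then show ?thesis using assms gens_carrier by (auto simp: word_prod_def)
qed

text \<open>Collects what the argument takes from the Coxeter presentation. In this form the
  assumptions pass to \<open>subgroup_generated W I\<close> and survive negation of the height, so
  the lemmas proved here can be instantiated for both.\<close>

locale involutive_quasiparabolic_set = quasiparabolic_set W S X \<phi> ht
  for W (structure) and S :: "'a set" and X :: "'x set" and \<phi> :: "'a \<Rightarrow> 'x \<Rightarrow> 'x" and ht :: "'x \<Rightarrow> int" +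
  assumes gens_subset: "S \<subseteq> carrier W"
    and square: "s \<in> S \<Longrightarrow> s \<otimes> s = \<one>"
begin

sublocale group W
  using group_hom group_hom.axioms(1) by blast

abbreviation le :: "'x \<Rightarrow> 'x \<Rightarrow> bool"  (infix "\<preceq>" 50) where
  "x \<preceq> y \<equiv> (x, y) \<in> bruhat_order W S X \<phi> ht"

lemma le_refl: "x \<in> X \<Longrightarrow> x \<preceq> x"
  by (simp add: bruhat_order_def)

lemma le_trans: "\<lbrakk>x \<preceq> y; y \<preceq> z\<rbrakk> \<Longrightarrow> x \<preceq> z"
  by (auto simp: bruhat_order_def intro: rtrancl_trans)

lemma le_antisym: "\<lbrakk>x \<preceq> y; y \<preceq> x\<rbrakk> \<Longrightarrow> x = y"
  using bruhat_order_weakest(1)[OF gens_subset] by (auto simp: partial_order_on_def dest: antisymD)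

lemma le_reflection: "\<lbrakk>x \<in> X; r \<in> reflections W S; ht x \<le> ht (\<phi> r x)\<rbrakk> \<Longrightarrow> x \<preceq> \<phi> r x"
  using bruhat_order_weakest(2)[OF gens_subset] by blast

lemma reflection_carrier: "r \<in> reflections W S \<Longrightarrow> r \<in> carrier W"
  using reflections_subset_carrier[OF is_group gens_subset] by blast

lemma reflection_closed: "\<lbrakk>r \<in> reflections W S; x \<in> X\<rbrakk> \<Longrightarrow> \<phi> r x \<in> X"
  using reflection_carrier element_image by blast

lemma gens_reflection:
  assumes "s \<in> S"
  shows "s \<in> reflections W S"
proof -
  have "s = \<one> \<otimes> s \<otimes> inv \<one>" using assms gens_subset by auto
  then show ?thesis using assms unfolding reflections_def by blast
qed

lemma reflection_square:
  assumes "r \<in> reflections W S"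
  shows "r \<otimes> r = \<one>"
proof -
  obtain g s where g: "g \<in> carrier W" and s: "s \<in> S" and r: "r = g \<otimes> s \<otimes> inv g"
    using assms unfolding reflections_def by blast
  have sc: "s \<in> carrier W" using s gens_subset by blast
  have "r \<otimes> r = g \<otimes> (s \<otimes> (inv g \<otimes> g) \<otimes> s) \<otimes> inv g"
    using g sc unfolding r by (simp only: m_assoc m_closed inv_closed)
  then show ?thesis using g sc square[OF s] by simp
qed

lemma reflection_involutive:
  assumes "r \<in> reflections W S" "x \<in> X"
  shows "\<phi> r (\<phi> r x) = x"
  using composition_rule[of x r r] reflection_square[OF assms(1)] reflection_carrier[OF assms(1)]
    assms(2) id_eq_one by (metis restrict_apply')

lemma reflection_conjugate:
  assumes "r \<in> reflections W S" "s \<in> S"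
  shows "s \<otimes> r \<otimes> s \<in> reflections W S"
proof -
  obtain g t where g: "g \<in> carrier W" and t: "t \<in> S" and r: "r = g \<otimes> t \<otimes> inv g"
    using assms unfolding reflections_def by blast
  have c: "s \<in> carrier W" "t \<in> carrier W" using assms t gens_subset by auto
  have "inv s = s" using square[OF assms(2)] c by (simp add: inv_equality)
  then have "s \<otimes> r \<otimes> s = (s \<otimes> g) \<otimes> t \<otimes> inv (s \<otimes> g)"
    using g c unfolding r by (simp add: inv_mult_group m_assoc)
  then show ?thesis using g t c unfolding reflections_def by blast
qed

lemma reflection_step:
  assumes x: "x \<in> X" and r: "r \<in> reflections W S" and s: "s \<in> S" and h: "ht x < ht (\<phi> r x)"
  shows "\<phi> r x = \<phi> s x \<or> \<phi> s x \<preceq> \<phi> s (\<phi> r x)"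
proof (cases "ht (\<phi> s (\<phi> r x)) < ht (\<phi> s x)")
  case True
  then show ?thesis using QP2[OF r x s h] by simp
next
  case False
  have sR: "s \<in> reflections W S" by (rule gens_reflection[OF s])
  have sx: "\<phi> s x \<in> X" by (rule reflection_closed[OF sR x])
  \<comment> \<open>The reflection \<open>s \<otimes> r \<otimes> s\<close> joins the two points in
    question, so they are comparable in the direction given by their heights.\<close>
  have "\<phi> (s \<otimes> r \<otimes> s) (\<phi> s x) = \<phi> s (\<phi> r x)"
    using composition_rule[of "\<phi> s x" "s \<otimes> r" s] composition_rule[of x s r]
      reflection_involutive[OF sR x] sx x reflection_carrier[OF sR] reflection_carrier[OF r]
    by simp
  then show ?thesis
    using le_reflection[OF sx reflection_conjugate[OF r s]] False by simp
qed

section \<open>Minima and maxima under a generator; locally minimal elements\<close>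

lemma
  assumes "s \<in> S" "x \<in> X"
  shows lower_le: "lower \<phi> ht s x \<preceq> x" "lower \<phi> ht s x \<preceq> \<phi> s x"
    and upper_ge: "x \<preceq> upper \<phi> ht s x" "\<phi> s x \<preceq> upper \<phi> ht s x"
proof -
  have sR: "s \<in> reflections W S" by (rule gens_reflection[OF assms(1)])
  have sx: "\<phi> s x \<in> X" by (rule reflection_closed[OF sR assms(2)])
  have "\<phi> s x \<preceq> x" if "ht (\<phi> s x) < ht x"
    using le_reflection[OF sx sR] that reflection_involutive[OF sR assms(2)] by simp
  moreover have "x \<preceq> \<phi> s x" if "\<not> ht (\<phi> s x) < ht x"
    using le_reflection[OF assms(2) sR] that by simp
  ultimately show "lower \<phi> ht s x \<preceq> x" "lower \<phi> ht s x \<preceq> \<phi> s x"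
    "x \<preceq> upper \<phi> ht s x" "\<phi> s x \<preceq> upper \<phi> ht s x"
    using le_refl assms(2) sx by (auto simp: lower_def upper_def)
qed

lemma lower_upper_step:
  assumes x: "x \<in> X" and r: "r \<in> reflections W S" and s: "s \<in> S" and h: "ht x < ht (\<phi> r x)"
  shows "lower \<phi> ht s x \<preceq> lower \<phi> ht s (\<phi> r x) \<and> upper \<phi> ht s x \<preceq> upper \<phi> ht s (\<phi> r x)"
proof -
  have sR: "s \<in> reflections W S" by (rule gens_reflection[OF s])
  have rx: "\<phi> r x \<in> X" by (rule reflection_closed[OF r x])
  have le: "x \<preceq> \<phi> r x" using le_reflection[OF x r] h by simp
  consider "\<phi> r x = \<phi> s x" | "\<phi> s x \<preceq> \<phi> s (\<phi> r x)"
    using reflection_step[OF assms] by blast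
  then show ?thesis
  proof cases
    case 1
    \<comment> \<open>Here \<open>s\<close> exchanges \<open>x\<close> and
      \<open>\<phi> r x\<close>, so both points have the same minimum and the same maximum.\<close>
    then have "lower \<phi> ht s (\<phi> r x) = x" "lower \<phi> ht s x = x"
      "upper \<phi> ht s (\<phi> r x) = \<phi> r x" "upper \<phi> ht s x = \<phi> r x"
      using h reflection_involutive[OF sR x] by (auto simp: lower_def upper_def)
    then show ?thesis using le_refl x rx by simp
  next
    case 2
    have "lower \<phi> ht s x \<preceq> \<phi> r x" "lower \<phi> ht s x \<preceq> \<phi> s (\<phi> r x)"
      "x \<preceq> upper \<phi> ht s (\<phi> r x)" "\<phi> s x \<preceq> upper \<phi> ht s (\<phi> r x)"
      using le_trans[OF lower_le(1)[OF s x] le] le_trans[OF lower_le(2)[OF s x] 2]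
        le_trans[OF le upper_ge(1)[OF s rx]] le_trans[OF 2 upper_ge(2)[OF s rx]] .
    \<comment> \<open>Only the minimum at \<open>\<phi> r x\<close> and the maximum at
      \<open>x\<close> are unfolded: \<open>lower \<phi> ht s x\<close> is below both candidates for
      the former, and \<open>upper \<phi> ht s (\<phi> r x)\<close> is above both candidates for the
      latter.\<close>
    then show ?thesis by (auto simp: lower_def[of _ _ _ "\<phi> r x"] upper_def[of _ _ _ x])
  qed
qed

lemma lower_upper_mono:
  assumes "x \<preceq> y" and s: "s \<in> S"
  shows "lower \<phi> ht s x \<preceq> lower \<phi> ht s y \<and> upper \<phi> ht s x \<preceq> upper \<phi> ht s y"
proof -
  have x: "x \<in> X" using assms(1) by (simp add: bruhat_order_def)
  have "(x, y) \<in> {(x, \<phi> r x) | x r. x \<in> X \<and> r \<in> reflections W S \<and> ht x < ht (\<phi> r x)}\<^sup>*"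
    using assms(1) by (simp add: bruhat_order_def)
  then show ?thesis
  proof (induction rule: rtrancl_induct)
    case base
    have "\<phi> s x \<in> X" using reflection_closed[OF gens_reflection[OF s] x] .
    then show ?case using x le_refl by (auto simp: lower_def upper_def)
  next
    case (step y z)
    then show ?case using lower_upper_step[OF _ _ s] le_trans by blast
  qed
qed

text \<open>Stated for every \<open>z\<close> above \<open>y\<close>, not just for
  \<open>z = y\<close>, so that in the product case of the induction the hypothesis for
  \<open>g\<close> can be applied at \<open>\<phi> h z\<close>.\<close>

lemma locally_minimal_le:
  assumes I: "I \<subseteq> S" and y: "y \<in> X" and min: "\<forall>s\<in>I. \<not> ht (\<phi> s y) < ht y"
    and g: "g \<in> generate W I" and "y \<preceq> z"
  shows "y \<preceq> \<phi> g z"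
proof -
  have step: "y \<preceq> \<phi> s z" if s: "s \<in> I" and le: "y \<preceq> z" for s z
  proof -
    have sS: "s \<in> S" and z: "z \<in> X" using s I le by (auto simp: bruhat_order_def)
    \<comment> \<open>Local minimality makes \<open>y\<close> its own minimum, so monotonicity puts
      it below the minimum of \<open>z\<close> and \<open>\<phi> s z\<close>.\<close>
    have "lower \<phi> ht s y = y" using min s by (auto simp: lower_def)
    then have "y \<preceq> lower \<phi> ht s z" using lower_upper_mono[OF le sS] by simp
    then show ?thesis by (rule le_trans) (rule lower_le(2)[OF sS z])
  qed
  have IC: "I \<subseteq> carrier W" using I gens_subset by blast
  show ?thesis
    using g \<open>y \<preceq> z\<close>
  proof (induction arbitrary: z)
    case one
    have "z \<in> X" using one by (simp add: bruhat_order_def)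
    then have "\<phi> \<one> z = z" using fun_cong[OF id_eq_one, of z] by simp
    then show ?case using one by simp
  next
    case (incl s)
    then show ?case by (rule step)
  next
    case (inv s)
    have "s \<in> S" using inv(1) I by blast
    then have "inv s = s" using square gens_subset by (blast intro: inv_equality)
    then show ?case using step[OF inv] by simp
  next
    case (eng g h)
    have "z \<in> X" using eng.prems by (simp add: bruhat_order_def)
    then have "\<phi> (g \<otimes> h) z = \<phi> g (\<phi> h z)"
      using composition_rule generate_in_carrier[OF IC eng.hyps(1)]
        generate_in_carrier[OF IC eng.hyps(2)] by blast
    then show ?case using eng.IH eng.prems by simp
  qed
qed

section \<open>Restriction to a parabolic subgroup\<close>

lemma involutive_parabolic:
  assumes "I \<subseteq> S"
  shows "involutive_quasiparabolic_set (subgroup_generated W I) I X \<phi> ht"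
proof -
  interpret P: quasiparabolic_set "subgroup_generated W I" I X \<phi> ht
    by (rule quasiparabolic_set_parabolic[OF gens_subset assms])
  show ?thesis
  proof
    show "I \<subseteq> carrier (subgroup_generated W I)"
      using assms gens_subset by (auto simp: carrier_subgroup_generated intro: generate.incl)
  qed (use assms square in auto)
qed

text \<open>Reflections of \<open>W\<^sub>I\<close> are reflections of \<open>W\<close>, so each
  upward step for \<open>W\<^sub>I\<close> is one for \<open>W\<close>. This is the easy implication
  of the theorem.\<close>

lemma bruhat_order_parabolic_subset:
  assumes "I \<subseteq> S"
  shows "bruhat_order (subgroup_generated W I) I X \<phi> ht \<subseteq> bruhat_order W S X \<phi> ht"
proof -
  have "reflections (subgroup_generated W I) I \<subseteq> reflections W S"
    using carrier_subgroup_generated_subset[of I] assms unfolding reflections_def by fastforce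
  then show ?thesis
    unfolding bruhat_order_def by (intro Int_mono rtrancl_mono) auto
qed

lemma bruhat_order_parabolic_bdd_below:
  assumes I: "I \<subseteq> S" and Orb: "Orb \<in> orbits (subgroup_generated W I) X \<phi>"
    and bdd: "bdd_below (ht ` Orb)"
    and "x \<preceq> y" "x \<in> Orb" "y \<in> Orb"
  shows "(x, y) \<in> bruhat_order (subgroup_generated W I) I X \<phi> ht"
proof -
  interpret P: involutive_quasiparabolic_set "subgroup_generated W I" I X \<phi> ht
    by (rule involutive_parabolic[OF I])
  obtain b where b: "\<And>z. z \<in> Orb \<Longrightarrow> b \<le> ht z"
    using bdd by (auto simp: bdd_below_def)
  obtain a where a: "a \<in> X" and Orb_a: "Orb = orbit (subgroup_generated W I) \<phi> a"
    using Orb by (auto simp: orbits_def)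
  have Orb_X: "Orb \<subseteq> X"
    using a P.element_image unfolding Orb_a orbit_def by blast
  have closed: "\<phi> s z \<in> Orb" if "s \<in> I" "z \<in> Orb" for s z
  proof -
    obtain g where g: "g \<in> carrier (subgroup_generated W I)" "z = \<phi> g a"
      using \<open>z \<in> Orb\<close> by (auto simp: Orb_a orbit_def)
    have s: "s \<in> carrier (subgroup_generated W I)" using \<open>s \<in> I\<close> P.gens_subset by blast
    have "\<phi> s z = \<phi> (s \<otimes>\<^bsub>subgroup_generated W I\<^esub> g) a"
      using P.composition_rule[OF a s g(1)] g(2) by simp
    then show ?thesis using s g(1) P.m_closed unfolding Orb_a orbit_def by blast
  qed
  have conn: "\<exists>g\<in>generate W I. z = \<phi> g y" if "y \<in> Orb" "z \<in> Orb" for y z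
  proof -
    have "z \<in> orbit (subgroup_generated W I) \<phi> y"
      using that Orb_X a P.orbit_sym P.orbit_trans unfolding Orb_a by blast
    \<comment> \<open>The carrier of \<open>subgroup_generated W I\<close> is generated by
      \<open>carrier W \<inter> I\<close>; this identity gives the form that
      \<open>locally_minimal_le\<close> expects.\<close>
    moreover have "carrier W \<inter> I = I" using I gens_subset by blast
    ultimately show ?thesis by (auto simp: orbit_def carrier_subgroup_generated)
  qed
  show ?thesis
    using \<open>x \<preceq> y\<close> \<open>x \<in> Orb\<close> \<open>y \<in> Orb\<close>
  \<comment> \<open>The bound \<open>b\<close> makes the height above it a natural number that drops
    from \<open>y\<close> to \<open>\<phi> s y\<close>; \<open>x\<close> is generalized because it
    gets replaced by its minimum.\<close>
  proof (induction "nat (ht y - b)" arbitrary: x y rule: less_induct)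
    case less
    have X: "x \<in> X" "y \<in> X" using less.prems Orb_X by auto
    show ?case
    proof (cases "\<exists>s\<in>I. ht (\<phi> s y) < ht y")
      case False
      \<comment> \<open>With no descent in \<open>I\<close>, \<open>y\<close> lies below its whole
        orbit, in particular below \<open>x\<close>; antisymmetry then forces
        \<open>x = y\<close>.\<close>
      obtain g where "g \<in> generate W I" "x = \<phi> g y" using conn less.prems by blast
      then have "y \<preceq> x" using locally_minimal_le[OF I X(2)] False le_refl X by blast
      then show ?thesis using le_antisym less.prems(1) P.le_refl X by blast
    next
      case True
      then obtain s where s: "s \<in> I" and sy: "ht (\<phi> s y) < ht y" by blast
      have sS: "s \<in> S" using s I by blast
      have sR: "s \<in> reflections W S" by (rule gens_reflection[OF sS])
      have "lower \<phi> ht s x \<preceq> \<phi> s y"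
        using lower_upper_mono[OF less.prems(1) sS] sy by (simp add: lower_def)
      moreover have "lower \<phi> ht s x \<in> Orb" "\<phi> s y \<in> Orb"
        using closed less.prems s by (auto simp: lower_def)
      moreover have "nat (ht (\<phi> s y) - b) < nat (ht y - b)"
        using sy b[OF \<open>\<phi> s y \<in> Orb\<close>] by simp
      ultimately have IH: "(lower \<phi> ht s x, \<phi> s y)
          \<in> bruhat_order (subgroup_generated W I) I X \<phi> ht"
        using less.hyps by blast
      have "upper \<phi> ht s (\<phi> s y) = y"
        using reflection_involutive[OF sR X(2)] sy by (simp add: upper_def)
      \<comment> \<open>Monotonicity of the maximum is now used inside \<open>W\<^sub>I\<close>, to
        undo the descent by \<open>s\<close>.\<close>
      then have "(upper \<phi> ht s (lower \<phi> ht s x), y)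
          \<in> bruhat_order (subgroup_generated W I) I X \<phi> ht"
        using P.lower_upper_mono[OF IH s] by simp
      \<comment> \<open>Passing to the minimum leaves the pair \<open>x\<close>,
        \<open>\<phi> s x\<close> unchanged, hence also its maximum, which lies above
        \<open>x\<close>.\<close>
      moreover have "upper \<phi> ht s (lower \<phi> ht s x) = upper \<phi> ht s x"
        using reflection_involutive[OF sR X(1)] by (auto simp: upper_def lower_def)
      ultimately show ?thesis using P.le_trans[OF P.upper_ge(1)[OF s X(1)]] by simp
    qed
  qed
qed

section \<open>Duality under negation of the height\<close>

lemma involutive_uminus: "involutive_quasiparabolic_set W S X \<phi> (\<lambda>x. - ht x)"
proof
  show "\<bar>- ht (\<phi> s x) - - ht x\<bar> \<le> 1" if "s \<in> S" "x \<in> X" for s x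
    using ht_step[OF that] by linarith
  show "\<phi> r x = x" if "r \<in> reflections W S" "x \<in> X" "- ht (\<phi> r x) = - ht x" for r x
    using QP1 that by simp
  show "\<phi> r x = \<phi> s x"
    if r: "r \<in> reflections W S" and x: "x \<in> X" and s: "s \<in> S"
      and h: "- ht x < - ht (\<phi> r x)" "- ht (\<phi> s (\<phi> r x)) < - ht (\<phi> s x)" for r x s
  proof -
    \<comment> \<open>(QP2) is self-dual: its negated hypotheses at \<open>x\<close> are the
      original ones at \<open>\<phi> r x\<close>, since \<open>r\<close> leads back to
      \<open>x\<close>.\<close>
    have "x = \<phi> s (\<phi> r x)"
      using QP2[OF r reflection_closed[OF r x] s] h reflection_involutive[OF r x] by simp
    then show ?thesis
      using reflection_involutive[OF gens_reflection[OF s] reflection_closed[OF r x]] by simp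
  qed
qed (use gens_subset square in auto)

lemma bruhat_order_uminus:
  "bruhat_order W S X \<phi> (\<lambda>x. - ht x) = (bruhat_order W S X \<phi> ht)\<inverse>"
proof -
  have "{(x, \<phi> r x) | x r. x \<in> X \<and> r \<in> reflections W S \<and> - ht x < - ht (\<phi> r x)} =
    {(x, \<phi> r x) | x r. x \<in> X \<and> r \<in> reflections W S \<and> ht x < ht (\<phi> r x)}\<inverse>"
    \<comment> \<open>The same reflection \<open>r\<close> traverses a step in the opposite
      direction.\<close>
    using reflection_involutive reflection_closed by auto metis+
  then show ?thesis
    unfolding bruhat_order_def by (auto simp: rtrancl_converse)
qed

end

theorem theorem5p8:
  fixes W :: "('w, 'b) monoid_scheme" and S I :: "'w set"
    and X :: "'x set" and \<phi> :: "'w \<Rightarrow> 'x \<Rightarrow> 'x" and ht :: "'x \<Rightarrow> int"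
  assumes "coxeter_system W S"
    and "quasiparabolic_set W S X \<phi> ht"
    and "I \<subseteq> S"
    and "Orb \<in> orbits (subgroup_generated W I) X \<phi>"
    and "bdd_below (ht ` Orb) \<or> bdd_above (ht ` Orb)"
    and "x \<in> Orb" and "y \<in> Orb"
  shows "(x, y) \<in> bruhat_order W S X \<phi> ht \<longleftrightarrow>
         (x, y) \<in> bruhat_order (subgroup_generated W I) I X \<phi> ht"
proof
  interpret Q: involutive_quasiparabolic_set W S X \<phi> ht
    using assms(1,2) coxeter_system.gens_carrier coxeter_system.gens_square
    by (intro involutive_quasiparabolic_set.intro involutive_quasiparabolic_set_axioms.intro) auto
  interpret P: involutive_quasiparabolic_set "subgroup_generated W I" I X \<phi> ht
    by (rule Q.involutive_parabolic[OF assms(3)])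
  show "(x, y) \<in> bruhat_order W S X \<phi> ht"
    if "(x, y) \<in> bruhat_order (subgroup_generated W I) I X \<phi> ht"
    using that Q.bruhat_order_parabolic_subset[OF assms(3)] by blast
  show "(x, y) \<in> bruhat_order (subgroup_generated W I) I X \<phi> ht"
    if le: "(x, y) \<in> bruhat_order W S X \<phi> ht"
    using assms(5)
  proof
    assume "bdd_below (ht ` Orb)"
    then show ?thesis
      using Q.bruhat_order_parabolic_bdd_below assms(3,4,6,7) le by blast
  next
    assume "bdd_above (ht ` Orb)"
    then obtain b where "\<And>z. z \<in> Orb \<Longrightarrow> ht z \<le> b"
      by (auto simp: bdd_above_def)
    \<comment> \<open>For the negated height the orbit is bounded below and \<open>y\<close> lies
      below \<open>x\<close>. The case bounded below applies to \<open>(y, x)\<close>, and reversing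
      the order of \<open>W\<^sub>I\<close> gives the claim.\<close>
    then have "bdd_below ((\<lambda>x. - ht x) ` Orb)"
      by (intro bdd_belowI[of _ "- b"]) auto
    moreover have "(y, x) \<in> bruhat_order W S X \<phi> (\<lambda>x. - ht x)"
      using le Q.bruhat_order_uminus by simp
    ultimately have "(y, x) \<in> bruhat_order (subgroup_generated W I) I X \<phi> (\<lambda>x. - ht x)"
      using involutive_quasiparabolic_set.bruhat_order_parabolic_bdd_below[OF Q.involutive_uminus]
        assms(3,4,6,7) by blast
    then show ?thesis using P.bruhat_order_uminus by simp
  qed
qed

end
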